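(* Fix $\varepsilon\in[0,1]$. In the market model described in the context, for every stage $k=0,1,\dots$, the double linear policy with pair $(\alpha,w)\in[0,1]\times\mathcal{W}$ yields a cumulative trading gain-loss $\mathcal{G}_k(\alpha,w,X,\varepsilon)=V(k)-V_0$ whose expected value $\overline{\mathcal{G}}_k(\alpha,w,\mu,\varepsilon):=\mathbb{E}[\mathcal{G}_k(\alpha,w,X,\varepsilon)]$ is $$\overline{\mathcal{G}}_k(\alpha,w,\mu,\varepsilon)=V_0\left(\alpha(1+w(\mu-\varepsilon))^k+(1-\alpha)(1-w(\mu+\varepsilon))^k-1\right).$$ Moreover, the corresponding variance is given by $$\begin{aligned}\mathrm{var}(\mathcal{G}_k(\alpha,w,X,\varepsilon))=\;&\alpha^2\left((1+w(\mu-\varepsilon))^2+w^2\sigma^2\right)^k+(1-\alpha)^2\left((1-w(\mu+\varepsilon))^2+w^2\sigma^2\right)^k\\&+2\alpha(1-\alpha)\left(1+2w\varepsilon-w^2((\mu^2+\sigma^2)-\varepsilon^2)\right)^k\\&-2\alpha(1+w(\mu-\varepsilon))^k-2(1-\alpha)(1-w(\mu+\varepsilon))^k+1\\&-\left(\alpha(1+w(\mu-\varepsilon))^k+(1-\alpha)(1-w(\mu+\varepsilon))^k-1\right)^2.\end{aligned}$$ The standard deviation of the cumulative trading gain-loss is $\mathrm{std}(\mathcal{G}_k(\alpha,w,X,\varepsilon))=\sqrt{\mathrm{var}(\mathcal{G}_k(\alpha,w,X,\varepsilon))}$.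
   Context: Market model: an asset has prices $S(k)>0$, $k=0,1,2,\dots$, and per-period returns $X(k)=\frac{S(k+1)-S(k)}{S(k)}$. The returns $X(0),X(1),\dots$ are independent random variables (with arbitrary distributions) with common mean $\mathbb{E}[X(k)]=\mu$ and common variance $\mathrm{var}(X(k))=\sigma^2\ge 0$, and almost surely $X_{\min}\le X(k)\le X_{\max}$ for all $k$, where $-1<X_{\min}<0<X_{\max}<\infty$ are known constants lying in the support of $X(k)$. In $\mathcal{G}_k(\alpha,w,X,\varepsilon)$, $X$ denotes the sequence $X(0),\dots,X(k-1)$. Double linear policy: let $V_0>0$ be the initial account value, $\alpha\in[0,1]$ an allocation constant, $\varepsilon\in[0,1]$ the transaction cost rate, and $w\in\mathcal{W}:=[0,w_{\max}]$ with $w_{\max}:=\min\left\{\frac{1}{1+\varepsilon},\frac{1}{X_{\max}+\varepsilon}\right\}$. Set $V_L(0)=\alpha V_0$ and $V_S(0)=(1-\alpha)V_0$, and define the policy by $\pi_L(k)=wV_L(k)$, $\pi_S(k)=-wV_S(k)$. The long and short account values evolve by $$V_L(k+1)=V_L(k)+X(k)\pi_L(k)-\varepsilon\pi_L(k),\qquad V_S(k+1)=V_S(k)+X(k)\pi_S(k)-\varepsilon|\pi_S(k)|,$$ where the short-side cost is $\varepsilon|\pi_S(k)|=\varepsilon wV_S(k)$. The overall account value is $V(k)=V_L(k)+V_S(k)$; explicitly $$V(k)=V_0\left(\alpha\prod_{j=0}^{k-1}\bigl(1+w(X(j)-\varepsilon)\bigr)+(1-\alpha)\prod_{j=0}^{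k-1}\bigl(1-w(X(j)+\varepsilon)\bigr)\right).$$
   Formalization: The printed variance formula is false; the formal statement multiplies it by an overall factor $V_0^2$ and replaces $+2w\varepsilon$ by $-2w\varepsilon$ in the mixed term $(1-2w\varepsilon-w^2((\mu^2+\sigma^2)-\varepsilon^2))^k$. *)

theory Defs
  imports "HOL-Probability.Probability"
begin

definition return_rate :: "(nat \<Rightarrow> 'a \<Rightarrow> real) \<Rightarrow> nat \<Rightarrow> 'a \<Rightarrow> real" where
  "return_rate S k \<omega> = (S (Suc k) \<omega> - S k \<omega>) / S k \<omega>"

text \<open>Topological support of the law of a real random variable.\<close>

definition rv_support :: "'a measure \<Rightarrow> ('a \<Rightarrow> real) \<Rightarrow> real set" where
  "rv_support M X = {x. \<forall>U. open U \<and> x \<in> U \<longrightarrow> measure (distr M borel X) U > 0}"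

locale market_model = prob_space M
  for M :: "'a measure" and S :: "nat \<Rightarrow> 'a \<Rightarrow> real"
    and \<mu> \<sigma> Xmin Xmax :: real +
  assumes price_measurable: "random_variable borel (S k)"
    and price_pos: "\<omega> \<in> space M \<Longrightarrow> S k \<omega> > 0"
    and returns_indep: "indep_vars (\<lambda>_. borel) (return_rate S) UNIV"
    and returns_mean: "expectation (return_rate S k) = \<mu>"
    and sigma_nonneg: "\<sigma> \<ge> 0"
    and returns_variance: "variance (return_rate S k) = \<sigma>\<^sup>2"
    and bounds: "-1 < Xmin" "Xmin < 0" "0 < Xmax"
    and returns_bounded: "AE \<omega> in M. \<forall>k. Xmin \<le> return_rate S k \<omega> \<and> return_rate S k \<omega> \<le> Xmax"
    and bounds_in_support:
      "Xmin \<in> rv_support M (return_rate S k)" "Xmax \<in> rv_support M (return_rate S k)"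

definition w_max :: "real \<Rightarrow> real \<Rightarrow> real" where
  "w_max Xmax \<epsilon> = min (1 / (1 + \<epsilon>)) (1 / (Xmax + \<epsilon>))"

definition admissible_weights :: "real \<Rightarrow> real \<Rightarrow> real set" where
  "admissible_weights Xmax \<epsilon> = {0..w_max Xmax \<epsilon>}"

definition long_policy :: "real \<Rightarrow> real \<Rightarrow> real" where
  "long_policy w v = w * v"

definition short_policy :: "real \<Rightarrow> real \<Rightarrow> real" where
  "short_policy w v = - w * v"

text \<open>In the accounts below, \<open>x\<close> is one realised sequence of returns.\<close>

primrec long_account ::
    "real \<Rightarrow> real \<Rightarrow> real \<Rightarrow> real \<Rightarrow> (nat \<Rightarrow> real) \<Rightarrow> nat \<Rightarrow> real" where
  "long_account V0 \<alpha> w \<epsilon> x 0 = \<alpha> * V0"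
| "long_account V0 \<alpha> w \<epsilon> x (Suc k) =
     long_account V0 \<alpha> w \<epsilon> x k
     + x k * long_policy w (long_account V0 \<alpha> w \<epsilon> x k)
     - \<epsilon> * long_policy w (long_account V0 \<alpha> w \<epsilon> x k)"

primrec short_account ::
    "real \<Rightarrow> real \<Rightarrow> real \<Rightarrow> real \<Rightarrow> (nat \<Rightarrow> real) \<Rightarrow> nat \<Rightarrow> real" where
  "short_account V0 \<alpha> w \<epsilon> x 0 = (1 - \<alpha>) * V0"
| "short_account V0 \<alpha> w \<epsilon> x (Suc k) =
     short_account V0 \<alpha> w \<epsilon> x k
     + x k * short_policy w (short_account V0 \<alpha> w \<epsilon> x k)
     - \<epsilon> * \<bar>short_policy w (short_account V0 \<alpha> w \<epsilon> x k)\<bar>"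

definition account_value ::
    "real \<Rightarrow> real \<Rightarrow> real \<Rightarrow> real \<Rightarrow> (nat \<Rightarrow> real) \<Rightarrow> nat \<Rightarrow> real" where
  "account_value V0 \<alpha> w \<epsilon> x k = long_account V0 \<alpha> w \<epsilon> x k + short_account V0 \<alpha> w \<epsilon> x k"

definition gain_loss ::
    "real \<Rightarrow> nat \<Rightarrow> real \<Rightarrow> real \<Rightarrow> (nat \<Rightarrow> real) \<Rightarrow> real \<Rightarrow> real" where
  "gain_loss V0 k \<alpha> w x \<epsilon> = account_value V0 \<alpha> w \<epsilon> x k - V0"

definition trading_gain ::
    "(nat \<Rightarrow> 'a \<Rightarrow> real) \<Rightarrow> real \<Rightarrow> nat \<Rightarrow> real \<Rightarrow> real \<Rightarrow> real \<Rightarrow> 'a \<Rightarrow> real" where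
  "trading_gain S V0 k \<alpha> w \<epsilon> \<omega> = gain_loss V0 k \<alpha> w (\<lambda>j. return_rate S j \<omega>) \<epsilon>"

definition std_dev :: "'a measure \<Rightarrow> ('a \<Rightarrow> real) \<Rightarrow> real" where
  "std_dev M Y = sqrt (prob_space.variance M Y)"

text \<open>
  For one return \<open>x\<close>, the product of the long and short growth factors is
  \<open>(1 + w * (x - \<epsilon>)) * (1 - w * (x + \<epsilon>)) = 1 - 2 * w * \<epsilon> - w\<^sup>2 * (x\<^sup>2 - \<epsilon>\<^sup>2)\<close>, and the gain-loss
  is proportional to \<open>V0\<close>. The variance formula is therefore stated with \<open>- 2 * w * \<epsilon>\<close> in its
  mixed term and with an overall factor \<open>V0\<^sup>2\<close>. The published formula has \<open>+ 2 * w * \<epsilon>\<close> and no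
  such factor; as printed it fails, e.g. for \<open>k = 1\<close>, \<open>V0 = 1\<close>, \<open>\<alpha> = w = \<epsilon> = 1/2\<close> and returns
  \<open>1/2\<close> and \<open>- 1/2\<close> with equal probability: it gives \<open>1/2\<close>, but the gain-loss is constant.
\<close>

end

theory Submission
  imports Defs
begin

text \<open>
  The weight bound \<open>w \<le> 1 / (Xmax + \<epsilon>)\<close> keeps the short account nonnegative almost surely, so the
  absolute value in its cost can be dropped and both accounts are products of growth factors
  \<open>a + b * X j\<close>. The gain-loss and its square are then linear combinations of products over \<open>j\<close> of
  one fixed function of \<open>X j\<close>, and independence turns each expectation into a \<open>k\<close>-th power.
\<close>

text \<open>Independence survives composition with the measurable function \<open>g\<close>, so the
  expectation of the product factors. The laws of the \<open>X j\<close> may differ with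
  \<open>j\<close>; a \<open>k\<close>-th power results because all \<open>g (X j)\<close> share the
  mean \<open>m\<close>.\<close>

lemma (in prob_space) has_bochner_integral_prod_indep:
  fixes X :: "nat \<Rightarrow> 'a \<Rightarrow> real" and g :: "real \<Rightarrow> real"
  assumes "indep_vars (\<lambda>_. borel) X UNIV"
    and "g \<in> borel_measurable borel"
    and "\<And>j. has_bochner_integral M (\<lambda>\<omega>. g (X j \<omega>)) m"
  shows "has_bochner_integral M (\<lambda>\<omega>. \<Prod>j<k. g (X j \<omega>)) (m ^ k)"
proof -
  have indep: "indep_vars (\<lambda>_. borel) (\<lambda>j \<omega>. g (X j \<omega>)) {..<k}"
    by (rule indep_vars_compose2[OF indep_vars_subset[OF assms(1)]]) (use assms(2) in auto)
  have "integrable M (\<lambda>\<omega>. g (X j \<omega>))" "expectation (\<lambda>\<omega>. g (X j \<omega>)) = m" for j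
    using assms(3) by (auto simp: has_bochner_integral_iff)
  then show ?thesis
    using indep_vars_integrable[OF _ indep] indep_vars_lebesgue_integral[OF _ indep]
    by (simp add: has_bochner_integral_iff)
qed

lemma long_account_eq:
  "long_account V0 \<alpha> w \<epsilon> x k = V0 * (\<alpha> * (\<Prod>j<k. 1 + w * (x j - \<epsilon>)))"
  by (induction k) (simp_all add: long_policy_def algebra_simps)

text \<open>The product form at stage \<open>k\<close> itself shows that the account is nonnegative,
  since every factor is. This settles the sign inside the absolute value at the next stage and
  carries the induction.\<close>

lemma short_account_eq:
  assumes "V0 \<ge> 0" "\<alpha> \<le> 1" "w \<ge> 0" and "\<And>j. w * (x j + \<epsilon>) \<le> 1"
  shows "short_account V0 \<alpha> w \<epsilon> x k = V0 * ((1 - \<alpha>) * (\<Prod>j<k. 1 - w * (x j + \<epsilon>)))"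
proof (induction k)
  case (Suc k)
  have "short_account V0 \<alpha> w \<epsilon> x k \<ge> 0"
    unfolding Suc using assms by (auto intro!: mult_nonneg_nonneg prod_nonneg)
  then have "\<bar>short_policy w (short_account V0 \<alpha> w \<epsilon> x k)\<bar> = w * short_account V0 \<alpha> w \<epsilon> x k"
    using assms by (simp add: short_policy_def abs_mult)
  then have "short_account V0 \<alpha> w \<epsilon> x (Suc k)
      = short_account V0 \<alpha> w \<epsilon> x k * (1 - w * (x k + \<epsilon>))"
    by (simp add: short_policy_def algebra_simps)
  then show ?case
    by (simp add: Suc algebra_simps)
qed simp

text \<open>Since \<open>w\<close> is nonnegative, the worst case is \<open>x = Xmax\<close>, where
  the second argument of the minimum in \<open>w_max\<close> applies. This supplies the pathwise
  hypothesis of \<open>short_account_eq\<close>.\<close>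

lemma admissible_weight_growth:
  assumes "w \<in> admissible_weights Xmax \<epsilon>" "0 < Xmax" "0 \<le> \<epsilon>" "x \<le> Xmax"
  shows "w * (x + \<epsilon>) \<le> 1"
proof -
  have "w \<ge> 0" "w \<le> 1 / (Xmax + \<epsilon>)"
    using assms(1) by (auto simp: admissible_weights_def w_max_def)
  then have "w * (x + \<epsilon>) \<le> w * (Xmax + \<epsilon>)" "w * (Xmax + \<epsilon>) \<le> 1"
    using assms(2-4) by (auto simp: mult_left_mono pos_le_divide_eq)
  then show ?thesis by linarith
qed

context market_model
begin

lemma return_rate_measurable [measurable]: "return_rate S k \<in> borel_measurable M"
  using returns_indep by (auto simp: indep_vars_def)

text \<open>This goes through the recursion and not the product form: the latter is available only
  almost everywhere, which does not give measurability when \<open>M\<close> may be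
  incomplete.\<close>

lemma trading_gain_measurable: "trading_gain S V0 k \<alpha> w \<epsilon> \<in> borel_measurable M"
proof -
  have [measurable]:
    "(\<lambda>\<omega>. long_account V0 \<alpha> w \<epsilon> (\<lambda>j. return_rate S j \<omega>) k) \<in> borel_measurable M"
    by (induction k) (simp_all add: long_policy_def)
  have [measurable]:
    "(\<lambda>\<omega>. short_account V0 \<alpha> w \<epsilon> (\<lambda>j. return_rate S j \<omega>) k) \<in> borel_measurable M"
    by (induction k) (simp_all add: short_policy_def)
  show ?thesis
    unfolding trading_gain_def[abs_def] gain_loss_def account_value_def by measurable
qed

text \<open>Integrability has to come from the almost sure bounds, because the expectation of a
  non-integrable function is 0 by convention and \<open>returns_mean\<close> alone does not exclude
  that case. The second moment is then the variance plus the squared mean.\<close>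

lemma has_bochner_integral_return_rate:
  "has_bochner_integral M (return_rate S k) \<mu>"
  "has_bochner_integral M (\<lambda>\<omega>. (return_rate S k \<omega>)\<^sup>2) (\<mu>\<^sup>2 + \<sigma>\<^sup>2)"
proof -
  have bound: "AE \<omega> in M. \<bar>return_rate S k \<omega>\<bar> \<le> max (- Xmin) Xmax"
    using returns_bounded by (rule AE_mp) (auto intro!: AE_I2 dest!: spec[of _ k])
  have int1: "integrable M (return_rate S k)"
    by (rule integrable_const_bound[of _ "max (- Xmin) Xmax"]) (use bound in auto)
  have "AE \<omega> in M. norm ((return_rate S k \<omega>)\<^sup>2) \<le> (max (- Xmin) Xmax)\<^sup>2"
    using bound
  proof (rule AE_mp, intro AE_I2 impI)
    show "norm ((return_rate S k \<omega>)\<^sup>2) \<le> (max (- Xmin) Xmax)\<^sup>2"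
      if "\<bar>return_rate S k \<omega>\<bar> \<le> max (- Xmin) Xmax" for \<omega>
      using power_mono[OF that, of 2] by simp
  qed
  then have int2: "integrable M (\<lambda>\<omega>. (return_rate S k \<omega>)\<^sup>2)"
    by (rule integrable_const_bound) simp
  show "has_bochner_integral M (return_rate S k) \<mu>"
    using int1 returns_mean by (simp add: has_bochner_integral_iff)
  show "has_bochner_integral M (\<lambda>\<omega>. (return_rate S k \<omega>)\<^sup>2) (\<mu>\<^sup>2 + \<sigma>\<^sup>2)"
    using int2 variance_eq[OF int1 int2] returns_mean[of k] returns_variance[of k]
    by (simp add: has_bochner_integral_iff)
qed

text \<open>The expectation of a quadratic in one return depends only on the first two moments,
  which are the same at every stage. All moments of the growth products needed below are
  instances.\<close>

lemma has_bochner_integral_prod_quadratic: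
  fixes a b c :: real
  assumes "\<And>x. g x = a + b * x + c * x\<^sup>2"
  shows "has_bochner_integral M (\<lambda>\<omega>. \<Prod>j<k. g (return_rate S j \<omega>))
    ((a + b * \<mu> + c * (\<mu>\<^sup>2 + \<sigma>\<^sup>2)) ^ k)"
proof (rule has_bochner_integral_prod_indep[OF returns_indep])
  show "g \<in> borel_measurable borel"
    unfolding assms[abs_def] by measurable
  have "has_bochner_integral M (\<lambda>_. a) a"
    by (simp add: has_bochner_integral_iff prob_space)
  then show "has_bochner_integral M (\<lambda>\<omega>. g (return_rate S j \<omega>)) (a + b * \<mu> + c * (\<mu>\<^sup>2 + \<sigma>\<^sup>2))"
    for j
    unfolding assms
    by (intro has_bochner_integral_add has_bochner_integral_mult_right
        has_bochner_integral_return_rate)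
qed

lemma has_bochner_integral_growth:
  fixes w \<epsilon> :: real and k :: nat
  defines "A \<equiv> \<lambda>\<omega>. \<Prod>j<k. 1 + w * (return_rate S j \<omega> - \<epsilon>)"
    and "B \<equiv> \<lambda>\<omega>. \<Prod>j<k. 1 - w * (return_rate S j \<omega> + \<epsilon>)"
  shows "has_bochner_integral M A ((1 + w * (\<mu> - \<epsilon>)) ^ k)"
    and "has_bochner_integral M B ((1 - w * (\<mu> + \<epsilon>)) ^ k)"
    and "has_bochner_integral M (\<lambda>\<omega>. (A \<omega>)\<^sup>2) (((1 + w * (\<mu> - \<epsilon>))\<^sup>2 + w\<^sup>2 * \<sigma>\<^sup>2) ^ k)"
    and "has_bochner_integral M (\<lambda>\<omega>. (B \<omega>)\<^sup>2) (((1 - w * (\<mu> + \<epsilon>))\<^sup>2 + w\<^sup>2 * \<sigma>\<^sup>2) ^ k)"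
    and "has_bochner_integral M (\<lambda>\<omega>. A \<omega> * B \<omega>)
      ((1 - 2 * w * \<epsilon> - w\<^sup>2 * ((\<mu>\<^sup>2 + \<sigma>\<^sup>2) - \<epsilon>\<^sup>2)) ^ k)"
proof -
  note quad = has_bochner_integral_prod_quadratic[where k = k]
  note simps = power2_eq_square algebra_simps
  \<comment> \<open>For the first moments the growth factors are affine, hence quadratics with
    \<open>c = 0\<close>.\<close>
  show "has_bochner_integral M A ((1 + w * (\<mu> - \<epsilon>)) ^ k)"
    using quad[of "\<lambda>x. 1 + w * (x - \<epsilon>)" "1 - w * \<epsilon>" w 0] unfolding A_def
    by (simp add: simps)
  show "has_bochner_integral M B ((1 - w * (\<mu> + \<epsilon>)) ^ k)"
    using quad[of "\<lambda>x. 1 - w * (x + \<epsilon>)" "1 - w * \<epsilon>" "- w" 0] unfolding B_def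
    by (simp add: simps)
  \<comment> \<open>The left side averages \<open>(1 - w * \<epsilon> + w * x)\<^sup>2\<close>. As
    \<open>x\<^sup>2\<close> has mean \<open>\<mu>\<^sup>2 + \<sigma>\<^sup>2\<close>, this is the
    value at \<mu> plus \<open>w\<^sup>2 * \<sigma>\<^sup>2\<close>. The short side differs only in
    the sign of the linear coefficient.\<close>
  have "(1 - w * \<epsilon>)\<^sup>2 + 2 * w * (1 - w * \<epsilon>) * \<mu> + w\<^sup>2 * (\<mu>\<^sup>2 + \<sigma>\<^sup>2)
      = (1 + w * (\<mu> - \<epsilon>))\<^sup>2 + w\<^sup>2 * \<sigma>\<^sup>2"
    by (simp add: simps)
  then show "has_bochner_integral M (\<lambda>\<omega>. (A \<omega>)\<^sup>2) (((1 + w * (\<mu> - \<epsilon>))\<^sup>2 + w\<^sup>2 * \<sigma>\<^sup>2) ^ k)"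
    using quad[of "\<lambda>x. (1 + w * (x - \<epsilon>))\<^sup>2" "(1 - w * \<epsilon>)\<^sup>2" "2 * w * (1 - w * \<epsilon>)" "w\<^sup>2"]
    unfolding A_def prod_power_distrib by (simp add: simps)
  have "(1 - w * \<epsilon>)\<^sup>2 + (- 2 * w * (1 - w * \<epsilon>)) * \<mu> + w\<^sup>2 * (\<mu>\<^sup>2 + \<sigma>\<^sup>2)
      = (1 - w * (\<mu> + \<epsilon>))\<^sup>2 + w\<^sup>2 * \<sigma>\<^sup>2"
    by (simp add: simps)
  then show "has_bochner_integral M (\<lambda>\<omega>. (B \<omega>)\<^sup>2) (((1 - w * (\<mu> + \<epsilon>))\<^sup>2 + w\<^sup>2 * \<sigma>\<^sup>2) ^ k)"
    using quad[of "\<lambda>x. (1 - w * (x + \<epsilon>))\<^sup>2" "(1 - w * \<epsilon>)\<^sup>2" "- 2 * w * (1 - w * \<epsilon>)" "w\<^sup>2"]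
    unfolding B_def prod_power_distrib by (simp add: simps)
  \<comment> \<open>With \<open>u = 1 - w * \<epsilon>\<close> the two factors are
    \<open>u + w * x\<close> and \<open>u - w * x\<close>. Their product
    \<open>u\<^sup>2 - w\<^sup>2 * x\<^sup>2\<close> has no linear term, and expanding
    \<open>u\<^sup>2\<close> produces \<open>- 2 * w * \<epsilon>\<close>.\<close>
  have "(1 - w * \<epsilon>)\<^sup>2 + 0 * \<mu> + (- w\<^sup>2) * (\<mu>\<^sup>2 + \<sigma>\<^sup>2)
      = 1 - 2 * w * \<epsilon> - w\<^sup>2 * ((\<mu>\<^sup>2 + \<sigma>\<^sup>2) - \<epsilon>\<^sup>2)"
    by (simp add: simps)
  then show "has_bochner_integral M (\<lambda>\<omega>. A \<omega> * B \<omega>)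
      ((1 - 2 * w * \<epsilon> - w\<^sup>2 * ((\<mu>\<^sup>2 + \<sigma>\<^sup>2) - \<epsilon>\<^sup>2)) ^ k)"
    using quad[of "\<lambda>x. (1 + w * (x - \<epsilon>)) * (1 - w * (x + \<epsilon>))" "(1 - w * \<epsilon>)\<^sup>2" 0 "- w\<^sup>2"]
    unfolding A_def B_def prod.distrib[symmetric] by (simp add: simps)
qed

end

text \<open>The two integrability claims ensure that the mean and variance formulas speak of genuine
  integrals and not of the default value 0.\<close>

theorem mainTheorem2:
  fixes M :: "'a measure" and S :: "nat \<Rightarrow> 'a \<Rightarrow> real"
    and \<mu> \<sigma> Xmin Xmax \<epsilon> V0 \<alpha> w :: real and k :: nat
  assumes "market_model M S \<mu> \<sigma> Xmin Xmax"
    and "\<epsilon> \<in> {0..1}" and "V0 > 0"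
    and "\<alpha> \<in> {0..1}" and "w \<in> admissible_weights Xmax \<epsilon>"
  defines "G \<equiv> trading_gain S V0 k \<alpha> w \<epsilon>"
  shows "integrable M G
    \<and> integrable M (\<lambda>\<omega>. (G \<omega>)\<^sup>2)
    \<and> prob_space.expectation M G =
        V0 * (\<alpha> * (1 + w * (\<mu> - \<epsilon>)) ^ k + (1 - \<alpha>) * (1 - w * (\<mu> + \<epsilon>)) ^ k - 1)
    \<and> prob_space.variance M G =
        V0\<^sup>2 *
        (\<alpha>\<^sup>2 * ((1 + w * (\<mu> - \<epsilon>))\<^sup>2 + w\<^sup>2 * \<sigma>\<^sup>2) ^ k
         + (1 - \<alpha>)\<^sup>2 * ((1 - w * (\<mu> + \<epsilon>))\<^sup>2 + w\<^sup>2 * \<sigma>\<^sup>2) ^ k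
         + 2 * \<alpha> * (1 - \<alpha>) * (1 - 2 * w * \<epsilon> - w\<^sup>2 * ((\<mu>\<^sup>2 + \<sigma>\<^sup>2) - \<epsilon>\<^sup>2)) ^ k
         - 2 * \<alpha> * (1 + w * (\<mu> - \<epsilon>)) ^ k
         - 2 * (1 - \<alpha>) * (1 - w * (\<mu> + \<epsilon>)) ^ k
         + 1
         - (\<alpha> * (1 + w * (\<mu> - \<epsilon>)) ^ k + (1 - \<alpha>) * (1 - w * (\<mu> + \<epsilon>)) ^ k - 1)\<^sup>2)
    \<and> std_dev M G = sqrt (prob_space.variance M G)"
proof -
  interpret market_model M S \<mu> \<sigma> Xmin Xmax by (rule assms(1))
  define A where "A \<omega> = (\<Prod>j<k. 1 + w * (return_rate S j \<omega> - \<epsilon>))" for \<omega>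
  define B where "B \<omega> = (\<Prod>j<k. 1 - w * (return_rate S j \<omega> + \<epsilon>))" for \<omega>
  let ?a = "(1 + w * (\<mu> - \<epsilon>)) ^ k" and ?b = "(1 - w * (\<mu> + \<epsilon>)) ^ k"
  let ?aa = "((1 + w * (\<mu> - \<epsilon>))\<^sup>2 + w\<^sup>2 * \<sigma>\<^sup>2) ^ k"
    and ?bb = "((1 - w * (\<mu> + \<epsilon>))\<^sup>2 + w\<^sup>2 * \<sigma>\<^sup>2) ^ k"
    and ?ab = "(1 - 2 * w * \<epsilon> - w\<^sup>2 * ((\<mu>\<^sup>2 + \<sigma>\<^sup>2) - \<epsilon>\<^sup>2)) ^ k"
  note growth = has_bochner_integral_growth[where k = k and w = w and \<epsilon> = \<epsilon>, folded A_def B_def]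
  have one: "has_bochner_integral M (\<lambda>_. 1) (1::real)"
    by (simp add: has_bochner_integral_iff prob_space)
  have [measurable]: "G \<in> borel_measurable M"
    unfolding G_def by (rule trading_gain_measurable)
  have "w \<ge> 0"
    using assms(5) by (simp add: admissible_weights_def)
  \<comment> \<open>The equation is confined to the almost sure event on which the returns respect
    their bounds; elsewhere the short account may change sign.\<close>
  have G_eq: "AE \<omega> in M. G \<omega> = V0 * (\<alpha> * A \<omega> + (1 - \<alpha>) * B \<omega> - 1)"
    using returns_bounded
  proof (rule AE_mp, intro AE_I2 impI)
    fix \<omega> assume "\<forall>j. Xmin \<le> return_rate S j \<omega> \<and> return_rate S j \<omega> \<le> Xmax"
    then have "w * (return_rate S j \<omega> + \<epsilon>) \<le> 1" for j
      using admissible_weight_growth[OF assms(5)] assms(2) bounds by auto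
    then show "G \<omega> = V0 * (\<alpha> * A \<omega> + (1 - \<alpha>) * B \<omega> - 1)"
      using assms(3,4) \<open>w \<ge> 0\<close>
      by (simp add: G_def trading_gain_def gain_loss_def account_value_def long_account_eq
          short_account_eq A_def B_def algebra_simps)
  qed
  have "has_bochner_integral M (\<lambda>\<omega>. V0 * (\<alpha> * A \<omega> + (1 - \<alpha>) * B \<omega> - 1))
      (V0 * (\<alpha> * ?a + (1 - \<alpha>) * ?b - 1))"
    by (intro has_bochner_integral_add has_bochner_integral_diff has_bochner_integral_mult_right
        growth one)
  \<comment> \<open>Passing between almost everywhere equal functions requires both to be
    measurable; for the explicit side this follows from the integral just computed.\<close>
  moreover from this have "has_bochner_integral M G x
      \<longleftrightarrow> has_bochner_integral M (\<lambda>\<omega>. V0 * (\<alpha> * A \<omega> + (1 - \<alpha>) * B \<omega> - 1)) x" for x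
    by (intro has_bochner_integral_cong_AE G_eq) (auto simp: has_bochner_integral_iff)
  ultimately have G: "has_bochner_integral M G (V0 * (\<alpha> * ?a + (1 - \<alpha>) * ?b - 1))"
    by simp
  \<comment> \<open>The square is expanded into a linear combination of the five products with known
    integrals and a constant, so that linearity applies.\<close>
  let ?sq = "\<lambda>\<omega>. V0\<^sup>2 * (\<alpha>\<^sup>2 * (A \<omega>)\<^sup>2 + (1 - \<alpha>)\<^sup>2 * (B \<omega>)\<^sup>2 + 2 * \<alpha> * (1 - \<alpha>) * (A \<omega> * B \<omega>)
    - 2 * \<alpha> * A \<omega> - 2 * (1 - \<alpha>) * B \<omega> + 1)"
  have sq_eq: "AE \<omega> in M. (G \<omega>)\<^sup>2 = ?sq \<omega>"
    using G_eq
  proof (rule AE_mp, intro AE_I2 impI)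
    show "(G \<omega>)\<^sup>2 = ?sq \<omega>" if "G \<omega> = V0 * (\<alpha> * A \<omega> + (1 - \<alpha>) * B \<omega> - 1)" for \<omega>
      unfolding that by (simp add: power2_eq_square algebra_simps)
  qed
  have "has_bochner_integral M ?sq (V0\<^sup>2 * (\<alpha>\<^sup>2 * ?aa + (1 - \<alpha>)\<^sup>2 * ?bb + 2 * \<alpha> * (1 - \<alpha>) * ?ab
      - 2 * \<alpha> * ?a - 2 * (1 - \<alpha>) * ?b + 1))" (is "has_bochner_integral M _ ?q")
    by (intro has_bochner_integral_add has_bochner_integral_diff has_bochner_integral_mult_right
        growth one)
  moreover from this have "has_bochner_integral M (\<lambda>\<omega>. (G \<omega>)\<^sup>2) x
      \<longleftrightarrow> has_bochner_integral M ?sq x" for x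
    by (intro has_bochner_integral_cong_AE sq_eq) (auto simp: has_bochner_integral_iff)
  ultimately have G2: "has_bochner_integral M (\<lambda>\<omega>. (G \<omega>)\<^sup>2) ?q"
    by simp
  have ints: "integrable M G" "integrable M (\<lambda>\<omega>. (G \<omega>)\<^sup>2)"
    and exps: "expectation G = V0 * (\<alpha> * ?a + (1 - \<alpha>) * ?b - 1)" "expectation (\<lambda>\<omega>. (G \<omega>)\<^sup>2) = ?q"
    using G G2 by (simp_all add: has_bochner_integral_iff)
  have "variance G = expectation (\<lambda>\<omega>. (G \<omega>)\<^sup>2) - (expectation G)\<^sup>2"
    by (rule variance_eq[OF ints])
  \<comment> \<open>The squared mean also carries the factor \<open>V0\<^sup>2\<close>, which
    therefore comes out of the whole difference.\<close>
  also have "\<dots> = V0\<^sup>2 * (\<alpha>\<^sup>2 * ?aa + (1 - \<alpha>)\<^sup>2 * ?bb + 2 * \<alpha> * (1 - \<alpha>) * ?ab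
      - 2 * \<alpha> * ?a - 2 * (1 - \<alpha>) * ?b + 1 - (\<alpha> * ?a + (1 - \<alpha>) * ?b - 1)\<^sup>2)"
    unfolding exps by (simp only: power_mult_distrib right_diff_distrib[symmetric])
  finally show ?thesis
    by (intro conjI ints exps(1) std_dev_def)
qed

end
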